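(* Suppose $\mathbb{Q}$ is the law of $Y \in \mathbb{R}^N$ with entries either i.i.d. $\mathcal{N}(0,1)$ or i.i.d. $\mathrm{Unif}(\{\pm 1\})$. Let $\mathbb{P}$ be a probability measure on $\mathbb{R}^N$ that is absolutely continuous with respect to $\mathbb{Q}$, with likelihood ratio $L = d\mathbb{P}/d\mathbb{Q} \in L^2(\mathbb{Q})$. Let $M = M(Y)$ be a real symmetric $\ell \times \ell$ matrix, each of whose entries is a polynomial in $Y$ of degree at most $d$. Let $k \in \mathbb{N}$, and suppose $$\mathbb{E}_{Y\sim\mathbb{P}} \|M(Y)\|_{\mathrm{op}} \ge A \quad\text{and}\quad \mathbb{Q}\big(\|M(Y)\|_{\mathrm{op}} \ge B\big) \le \delta$$ for some $A > B > 0$ and some $\delta \le \frac12 \cdot 3^{-4kd}$, where $\|\cdot\|_{\mathrm{op}}$ denotes the matrix operator norm. Then $$\|L^{\le 2kd}\| \ge \frac{1}{2\ell}\left(\frac{A}{B}\right)^{2k}.$$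
   Context: On $L^2(\mathbb{Q})$ use the inner product $\langle f,g\rangle = \mathbb{E}_{Y\sim\mathbb{Q}}[f(Y)g(Y)]$ and norm $\|f\| = \sqrt{\langle f,f\rangle}$. For an integer $D \ge 0$, $L^{\le D}$ (the $D$-low-degree likelihood ratio) is the orthogonal projection in $L^2(\mathbb{Q})$ of $L$ onto the linear subspace of (functions given by) polynomials $\mathbb{R}^N\to\mathbb{R}$ of total degree at most $D$. *)

theory Defs
  imports "HOL-Probability.Probability"
begin

text \<open>The law of a random vector in \<open>\<real>\<^sup>N\<close> (with \<open>N = CARD('n)\<close>) whose entries are i.i.d.
  with law \<open>\<mu>\<close>.\<close>

definition iid_law :: "real measure \<Rightarrow> (real ^ 'n) measure" where
  "iid_law \<mu> = distr (PiM (UNIV :: 'n set) (\<lambda>_. \<mu>)) borel (\<lambda>f. \<chi> i. f i)"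

definition std_normal_law :: "real measure" where
  "std_normal_law = density lborel (\<lambda>x. ennreal (std_normal_density x))"

definition rademacher_law :: "real measure" where
  "rademacher_law = distr (measure_pmf (pmf_of_set {- 1, 1})) borel (\<lambda>x. x)"

lemma prob_space_std_normal_law: "prob_space std_normal_law"
  unfolding std_normal_law_def by (intro prob_space_normal_density) simp

lemma prob_space_rademacher_law: "prob_space rademacher_law"
  unfolding rademacher_law_def by (intro measure_pmf.prob_space_distr) simp

lemma measurable_vec_of_fun:
  assumes "sets \<mu> = sets borel"
  shows "(\<lambda>f. \<chi> i. f i) \<in> PiM (UNIV :: 'n set) (\<lambda>_. \<mu>) \<rightarrow>\<^sub>M (borel :: (real ^ 'n) measure)"
proof (rule borel_measurable_euclidean_space[THEN iffD2], rule ballI)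
  fix b :: "real ^ 'n" assume "b \<in> Basis"
  then obtain j where b: "b = axis j 1" by (auto simp: Basis_vec_def)
  have "(\<lambda>f. f j) \<in> PiM (UNIV :: 'n set) (\<lambda>_. \<mu>) \<rightarrow>\<^sub>M \<mu>" by simp
  then have "(\<lambda>f. f j) \<in> PiM (UNIV :: 'n set) (\<lambda>_. \<mu>) \<rightarrow>\<^sub>M borel"
    using assms measurable_cong_sets by blast
  then show "(\<lambda>f. (\<chi> i. f i) \<bullet> b) \<in> borel_measurable (PiM (UNIV :: 'n set) (\<lambda>_. \<mu>))"
    by (simp add: b inner_axis)
qed

lemma prob_space_iid_law:
  assumes "prob_space \<mu>" "sets \<mu> = sets borel"
  shows "prob_space (iid_law \<mu> :: (real ^ 'n) measure)"
proof -
  interpret product_prob_space "\<lambda>_ :: 'n. \<mu>" UNIV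
    by (simp add: assms(1) product_prob_spaceI)
  show ?thesis
    unfolding iid_law_def by (intro prob_space_distr measurable_vec_of_fun assms(2))
qed

text \<open>The functions on \<open>\<real>\<^sup>N\<close> given by polynomials of total degree at most \<open>D\<close>.  The index
  set of the sum, the exponent vectors \<open>a\<close> with \<open>\<bar>a\<bar> \<le> D\<close>, is finite.\<close>

definition poly_funs :: "nat \<Rightarrow> (real ^ 'n \<Rightarrow> real) set" where
  "poly_funs D =
     {p. \<exists>c :: ('n \<Rightarrow> nat) \<Rightarrow> real.
           p = (\<lambda>x. \<Sum>a \<in> {a. (\<Sum>i\<in>UNIV. a i) \<le> D}. c a * (\<Prod>i\<in>UNIV. (x $ i) ^ a i))}"

lemma finite_exponents: "finite {a :: 'n::finite \<Rightarrow> nat. (\<Sum>i\<in>UNIV. a i) \<le> D}"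
proof (rule finite_subset)
  show "{a :: 'n \<Rightarrow> nat. (\<Sum>i\<in>UNIV. a i) \<le> D} \<subseteq> PiE UNIV (\<lambda>_. {..D})"
    by (auto simp: PiE_def) (meson UNIV_I finite member_le_sum order_trans zero_le)
qed (simp add: finite_PiE)

definition L2_inner :: "'a measure \<Rightarrow> ('a \<Rightarrow> real) \<Rightarrow> ('a \<Rightarrow> real) \<Rightarrow> real" where
  "L2_inner Q f g = (\<integral>y. f y * g y \<partial>Q)"

definition L2_norm :: "'a measure \<Rightarrow> ('a \<Rightarrow> real) \<Rightarrow> real" where
  "L2_norm Q f = sqrt (L2_inner Q f f)"

text \<open>A representative of the orthogonal projection of \<open>f\<close> onto the subspace \<open>V\<close> of \<open>L\<^sup>2(Q)\<close>;
  it is determined by the defining property only up to \<open>Q\<close>-null sets.\<close>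

definition L2_proj :: "'a measure \<Rightarrow> ('a \<Rightarrow> real) set \<Rightarrow> ('a \<Rightarrow> real) \<Rightarrow> 'a \<Rightarrow> real" where
  "L2_proj Q V f = (SOME p. p \<in> V \<and> (\<forall>q\<in>V. L2_inner Q (\<lambda>y. f y - p y) q = 0))"

definition likelihood_ratio :: "'a measure \<Rightarrow> 'a measure \<Rightarrow> 'a \<Rightarrow> real" where
  "likelihood_ratio Q P y = enn2real (RN_deriv Q P y)"

definition low_degree_LR :: "(real ^ 'n) measure \<Rightarrow> (real ^ 'n) measure \<Rightarrow> nat \<Rightarrow> real ^ 'n \<Rightarrow> real"
  where "low_degree_LR Q P D = L2_proj Q (poly_funs D) (likelihood_ratio Q P)"

definition op_norm :: "real ^ 'l ^ 'l \<Rightarrow> real" where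
  "op_norm A = onorm (\<lambda>v. A *v v)"

end

theory Submission
  imports Defs "HOL-Real_Asymp.Real_Asymp"
begin

text \<open>
  The matrix enters through the single polynomial \<open>f = tr (M\<^sup>2\<^sup>k)\<close> of degree at most
  \<open>D = 2kd\<close>.  It satisfies \<open>\<parallel>M\<parallel>\<^sup>2\<^sup>k \<le> f \<le> l \<parallel>M\<parallel>\<^sup>2\<^sup>k\<close>, where \<open>l\<close> is the size of \<open>M\<close>.
  Since \<open>f\<close> has degree at most \<open>D\<close>, its expectation under \<open>P\<close>, which is the inner product of
  \<open>f\<close> with the likelihood ratio, is also its inner product with the low-degree likelihood
  ratio.  By Cauchy--Schwarz, the norm of the latter is at least \<open>E\<^sub>P f / \<parallel>f\<parallel>\<close>
  (\<open>L2_norm_proj_ge\<close>).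

  The numerator is at least \<open>A\<^sup>2\<^sup>k\<close> by Jensen's inequality.  For the denominator, \<open>f\<close> is at
  most \<open>l B\<^sup>2\<^sup>k\<close> off an event of probability at most \<open>\<delta>\<close>, and that event contributes at most the
  fraction \<open>3 / 4\<close> of the second moment of \<open>f\<close> (\<open>poly_second_moment_le\<close>).  So
  \<open>\<parallel>f\<parallel> \<le> 2 l B\<^sup>2\<^sup>k\<close>.

  The probabilistic input is hypercontractivity: \<open>E p\<^sup>4 \<le> 9\<^sup>D (E p\<^sup>2)\<^sup>2\<close> for polynomials
  \<open>p\<close> of degree at most \<open>D\<close>.  It is proved for \<open>p (\<epsilon>\<^sub>1 v\<^sub>1 + \<dots> + \<epsilon>\<^sub>m v\<^sub>m)\<close> with random signs
  \<open>\<epsilon>\<^sub>i\<close> and arbitrary vectors \<open>v\<^sub>i\<close>, by induction on \<open>m\<close> (\<open>sign_avg_hypercontractive\<close>).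
  Rademacher vectors have this form.  The moments of Gaussian vectors are limits of moments of
  such sums (\<open>sign_sum_moment_tendsto\<close>), and the inequality involves nothing but moments.
\<close>

section \<open>Polynomial functions\<close>

definition monomial_fun :: "('n::finite \<Rightarrow> nat) \<Rightarrow> real ^ 'n \<Rightarrow> real" where
  "monomial_fun a x = (\<Prod>i\<in>UNIV. (x $ i) ^ a i)"

lemma poly_funs_iff:
  "p \<in> poly_funs D \<longleftrightarrow> (\<exists>c. p = (\<lambda>x. \<Sum>a | (\<Sum>i\<in>UNIV. a i) \<le> D. c a * monomial_fun a x))"
  by (simp add: poly_funs_def monomial_fun_def)

lemma poly_funs_combination: "(\<lambda>x. \<Sum>a | (\<Sum>i\<in>UNIV. a i) \<le> D. c a * monomial_fun a x) \<in> poly_funs D"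
  unfolding poly_funs_iff by (rule exI) (rule refl)

lemma poly_funs_add:
  assumes "p \<in> poly_funs D" "q \<in> poly_funs D"
  shows "(\<lambda>x. p x + q x) \<in> poly_funs D"
proof -
  obtain c where c: "p = (\<lambda>x. \<Sum>a | (\<Sum>i\<in>UNIV. a i) \<le> D. c a * monomial_fun a x)"
    using assms(1) unfolding poly_funs_iff by blast
  obtain c' where c': "q = (\<lambda>x. \<Sum>a | (\<Sum>i\<in>UNIV. a i) \<le> D. c' a * monomial_fun a x)"
    using assms(2) unfolding poly_funs_iff by blast
  have eq: "(\<lambda>x. p x + q x) = (\<lambda>x. \<Sum>a | (\<Sum>i\<in>UNIV. a i) \<le> D. (c a + c' a) * monomial_fun a x)"
    by (simp add: c c' sum.distrib distrib_right)
  show ?thesis unfolding eq by (rule poly_funs_combination)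
qed

lemma poly_funs_cmult:
  assumes "p \<in> poly_funs D"
  shows "(\<lambda>x. t * p x) \<in> poly_funs D"
proof -
  obtain c where c: "p = (\<lambda>x. \<Sum>a | (\<Sum>i\<in>UNIV. a i) \<le> D. c a * monomial_fun a x)"
    using assms unfolding poly_funs_iff by blast
  have eq: "(\<lambda>x. t * p x) = (\<lambda>x. \<Sum>a | (\<Sum>i\<in>UNIV. a i) \<le> D. (t * c a) * monomial_fun a x)"
    by (simp add: c sum_distrib_left mult.assoc)
  show ?thesis unfolding eq by (rule poly_funs_combination)
qed

lemma monomial_fun_in_poly_funs:
  fixes a :: "'n::finite \<Rightarrow> nat"
  assumes "(\<Sum>i\<in>UNIV. a i) \<le> D"
  shows "monomial_fun a \<in> poly_funs D"
proof -
  have eq: "monomial_fun a = (\<lambda>x. \<Sum>b | (\<Sum>i\<in>UNIV. b i) \<le> D. (if b = a then 1 else 0) * monomial_fun b x)"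
  proof
    fix x
    have "(\<Sum>b | (\<Sum>i\<in>UNIV. b i) \<le> D. (if b = a then 1 else 0) * monomial_fun b x)
        = (\<Sum>b | (\<Sum>i\<in>UNIV. b i) \<le> D. if b = a then monomial_fun b x else 0)"
      by (rule sum.cong) auto
    also have "\<dots> = monomial_fun a x"
      using assms by (simp add: finite_exponents)
    finally show "monomial_fun a x = (\<Sum>b | (\<Sum>i\<in>UNIV. b i) \<le> D. (if b = a then 1 else 0) * monomial_fun b x)"
      by simp
  qed
  show ?thesis by (subst eq) (rule poly_funs_combination)
qed

lemma poly_funs_const: "(\<lambda>x :: real ^ 'n. c) \<in> poly_funs D"
proof -
  have "monomial_fun (\<lambda>_ :: 'n. 0) = (\<lambda>x. 1)" by (auto simp: monomial_fun_def)
  then show ?thesis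
    using poly_funs_cmult[OF monomial_fun_in_poly_funs[of "\<lambda>_ :: 'n. 0" D], of c] by simp
qed

lemma poly_funs_sum:
  assumes "\<And>i. i \<in> I \<Longrightarrow> f i \<in> poly_funs D"
  shows "(\<lambda>x. \<Sum>i\<in>I. f i x) \<in> poly_funs D"
  using assms by (induction I rule: infinite_finite_induct) (auto intro: poly_funs_const poly_funs_add)

lemma poly_funs_monomial_induct [consumes 1, case_names monomial add]:
  fixes p :: "real ^ 'n \<Rightarrow> real"
  assumes p: "p \<in> poly_funs D"
    and mon: "\<And>c a. (\<Sum>i\<in>UNIV. a i) \<le> D \<Longrightarrow> P (\<lambda>x. c * monomial_fun a x)"
    and add: "\<And>p q. p \<in> poly_funs D \<Longrightarrow> q \<in> poly_funs D \<Longrightarrow> P p \<Longrightarrow> P q \<Longrightarrow> P (\<lambda>x. p x + q x)"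
  shows "P p"
proof -
  obtain c where c: "p = (\<lambda>x. \<Sum>a | (\<Sum>i\<in>UNIV. a i) \<le> D. c a * monomial_fun a x)"
    using p unfolding poly_funs_iff by blast
  have "P (\<lambda>x. \<Sum>a\<in>S. c a * monomial_fun a x)"
    if "finite S" "S \<subseteq> {a. (\<Sum>i\<in>UNIV. a i) \<le> D}" for S
    using that
  proof (induction S)
    case empty
    show ?case using mon[of "\<lambda>_. 0" 0] by simp
  next
    case (insert a S)
    have "P (\<lambda>x. c a * monomial_fun a x + (\<Sum>a\<in>S. c a * monomial_fun a x))"
      using insert by (intro add mon poly_funs_sum poly_funs_cmult monomial_fun_in_poly_funs) auto
    with insert show ?case by simp
  qed
  from this[OF finite_exponents] show ?thesis by (simp add: c)
qed

lemma monomial_fun_mult: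
  "monomial_fun a x * monomial_fun b x = monomial_fun (\<lambda>i. a i + b i) x"
  by (simp add: monomial_fun_def power_add prod.distrib)

lemma poly_funs_mult:
  assumes "p \<in> poly_funs D" "q \<in> poly_funs E"
  shows "(\<lambda>x. p x * q x) \<in> poly_funs (D + E)"
  using assms(1)
proof (induction rule: poly_funs_monomial_induct)
  case (monomial c a)
  from assms(2) show ?case
  proof (induction rule: poly_funs_monomial_induct)
    case (monomial c' b)
    have "(\<lambda>x. (c * c') * monomial_fun (\<lambda>i. a i + b i) x) \<in> poly_funs (D + E)"
      using monomial \<open>sum a UNIV \<le> D\<close>
      by (intro poly_funs_cmult monomial_fun_in_poly_funs) (simp add: sum.distrib)
    then show ?case by (simp add: monomial_fun_mult[symmetric] ac_simps)
  next
    case (add p q)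
    then show ?case using poly_funs_add[OF add(3,4)] by (simp add: algebra_simps)
  qed
next
  case (add p q)
  then show ?case using poly_funs_add[OF add(3,4)] by (simp add: algebra_simps)
qed

lemma poly_funs_power:
  assumes "p \<in> poly_funs D"
  shows "(\<lambda>x. p x ^ n) \<in> poly_funs (n * D)"
  by (induction n) (use poly_funs_const poly_funs_mult[OF assms] in auto)

lemma monomial_fun_unit:
  fixes i :: "'n::finite"
  shows "monomial_fun (\<lambda>j. if j = i then 1 else 0) = (\<lambda>x. x $ i)"
proof
  fix x :: "real ^ 'n"
  have "monomial_fun (\<lambda>j. if j = i then 1 else 0) x = (\<Prod>j\<in>UNIV. if j = i then x $ j else 1)"
    unfolding monomial_fun_def by (rule prod.cong) auto
  then show "monomial_fun (\<lambda>j. if j = i then 1 else 0) x = x $ i" by simp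
qed

lemma poly_funs_coord_mult:
  assumes "p \<in> poly_funs D"
  shows "(\<lambda>x. x $ i * p x) \<in> poly_funs (Suc D)"
proof -
  have "(\<lambda>x. x $ i) \<in> poly_funs 1"
    unfolding monomial_fun_unit[symmetric] by (rule monomial_fun_in_poly_funs) simp
  from poly_funs_mult[OF this assms] show ?thesis by simp
qed

text \<open>Every monomial is a constant or a coordinate times a monomial of smaller degree, so that a
  property depending on the degree bound can be proved by adding one coordinate factor at a time.\<close>

lemma poly_funs_induct [consumes 1, case_names const coord_mult add]:
  fixes p :: "real ^ 'n \<Rightarrow> real"
  assumes p: "p \<in> poly_funs D"
    and const: "\<And>D c. P D (\<lambda>x. c)"
    and coord_mult: "\<And>D i q. q \<in> poly_funs D \<Longrightarrow> P D q \<Longrightarrow> P (Suc D) (\<lambda>x. x $ i * q x)"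
    and add: "\<And>D p q. p \<in> poly_funs D \<Longrightarrow> q \<in> poly_funs D \<Longrightarrow> P D p \<Longrightarrow> P D q \<Longrightarrow> P D (\<lambda>x. p x + q x)"
  shows "P D p"
proof -
  have mon: "P D (\<lambda>x. c * monomial_fun a x)" if "(\<Sum>i\<in>UNIV. a i) \<le> D" for D c and a :: "'n \<Rightarrow> nat"
    using that
  proof (induction D arbitrary: a)
    case 0
    then have "a = (\<lambda>_. 0)" by auto
    then show ?case by (simp add: monomial_fun_def const)
  next
    case (Suc D)
    show ?case
    proof (cases "\<forall>i. a i = 0")
      case True
      then show ?thesis by (simp add: monomial_fun_def const)
    next
      case False
      then obtain i where i: "a i > 0" by auto
      define b where "b j = (if j = i then a i - 1 else a j)" for j
      have a: "a = (\<lambda>j. (if j = i then 1 else 0) + b j)" using i by (auto simp: b_def)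
      have "(\<Sum>j\<in>UNIV. a j) = 1 + (\<Sum>j\<in>UNIV. b j)"
        by (subst a) (simp add: sum.distrib)
      then have sb: "(\<Sum>j\<in>UNIV. b j) \<le> D" using Suc.prems by simp
      have "P (Suc D) (\<lambda>x. x $ i * (c * monomial_fun b x))"
        using sb by (intro coord_mult Suc.IH poly_funs_cmult monomial_fun_in_poly_funs)
      moreover have "monomial_fun a x = x $ i * monomial_fun b x" for x
        by (subst a) (simp add: monomial_fun_mult[symmetric] monomial_fun_unit del: One_nat_def)
      ultimately show ?thesis by (simp add: ac_simps)
    qed
  qed
  from p show ?thesis
    by (induction rule: poly_funs_monomial_induct) (auto intro: mon add)
qed

lemma poly_funs_shift:
  assumes "p \<in> poly_funs D"
  shows "(\<lambda>x. p (x + v)) \<in> poly_funs D"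
  using assms
proof (induction rule: poly_funs_induct)
  case (const D c)
  show ?case by (rule poly_funs_const)
next
  case (coord_mult D i q)
  have "(\<lambda>x. x $ i * q (x + v)) \<in> poly_funs (Suc D)"
    by (rule poly_funs_coord_mult) (rule coord_mult)
  moreover have "(\<lambda>x. v $ i * q (x + v)) \<in> poly_funs (Suc D)"
    using poly_funs_mult[OF poly_funs_const[of "v $ i" 1] coord_mult(2)] by simp
  ultimately show ?case using poly_funs_add by (fastforce simp: algebra_simps)
next
  case (add D p q)
  then show ?case by (intro poly_funs_add)
qed

lemma poly_funs_mean_shift:
  assumes "p \<in> poly_funs D"
  shows "(\<lambda>x. (p (x + v) + p (x - v)) / 2) \<in> poly_funs D"
  using poly_funs_cmult[OF poly_funs_add[OF poly_funs_shift[OF assms, of v] poly_funs_shift[OF assms, of "- v"]], of "1/2"]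
  by simp

text \<open>A symmetric difference kills the top degree part.  The drop by one degree is what
  makes the induction for the hypercontractive inequality close.  By the product rule, the half difference of
  \<open>x\<^sub>i q\<close> is \<open>x\<^sub>i\<close> times the half difference of \<open>q\<close> plus
  \<open>v\<^sub>i\<close> times the mean of the two shifts of \<open>q\<close>.\<close>

lemma poly_funs_half_difference:
  assumes "p \<in> poly_funs D"
  shows "(\<lambda>x. (p (x + v) - p (x - v)) / 2) \<in> poly_funs (D - 1) \<and> (D = 0 \<longrightarrow> (\<forall>x. p (x + v) = p (x - v)))"
  using assms
proof (induction rule: poly_funs_induct)
  case (const D c)
  show ?case by (simp add: poly_funs_const)
next
  case (coord_mult D i q)
  let ?\<Delta> = "\<lambda>x. (q (x + v) - q (x - v)) / 2"
  have 1: "(\<lambda>x. x $ i * ?\<Delta> x) \<in> poly_funs D"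
  proof (cases D)
    case 0
    with coord_mult.IH have "(\<lambda>x. x $ i * ?\<Delta> x) = (\<lambda>x. 0)" by auto
    then show ?thesis by (simp add: poly_funs_const del: mult_eq_0_iff)
  next
    case (Suc D')
    then show ?thesis using poly_funs_coord_mult[of ?\<Delta> D' i] coord_mult.IH by simp
  qed
  have 2: "(\<lambda>x. v $ i * ((q (x + v) + q (x - v)) / 2)) \<in> poly_funs D"
    by (intro poly_funs_cmult poly_funs_mean_shift coord_mult)
  have 3: "((x + v) $ i * q (x + v) - (x - v) $ i * q (x - v)) / 2
      = x $ i * ?\<Delta> x + v $ i * ((q (x + v) + q (x - v)) / 2)" for x
    by (simp add: field_simps)
  have "(\<lambda>x. ((x + v) $ i * q (x + v) - (x - v) $ i * q (x - v)) / 2) \<in> poly_funs D"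
    unfolding 3 by (rule poly_funs_add[OF 1 2])
  then show ?case by simp
next
  case (add D p q)
  have eq: "(p (x + v) + q (x + v) - (p (x - v) + q (x - v))) / 2
      = (p (x + v) - p (x - v)) / 2 + (q (x + v) - q (x - v)) / 2" for x by (simp add: field_simps)
  show ?case unfolding eq using add.IH poly_funs_add by fastforce
qed

section \<open>Averages over random signs\<close>

text \<open>The expectation of \<open>f (\<epsilon>\<^sub>1 v\<^sub>1 + \<dots> + \<epsilon>\<^sub>m v\<^sub>m)\<close> for independent uniform signs
  \<open>\<epsilon>\<^sub>i\<close>, where the list consists of the vectors \<open>v\<^sub>i\<close>.  Peeling off one sign at a time
  makes the average over it explicit.\<close>

primrec sign_avg :: "'a::real_vector list \<Rightarrow> ('a \<Rightarrow> real) \<Rightarrow> real" where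
  "sign_avg [] f = f 0"
| "sign_avg (v # vs) f = sign_avg vs (\<lambda>x. (f (x + v) + f (x - v)) / 2)"

lemma sign_avg_add: "sign_avg vs (\<lambda>x. f x + g x) = sign_avg vs f + sign_avg vs g"
proof (induction vs arbitrary: f g)
  case (Cons v vs)
  have "(\<lambda>x. (f (x + v) + g (x + v) + (f (x - v) + g (x - v))) / 2)
      = (\<lambda>x. (f (x + v) + f (x - v)) / 2 + (g (x + v) + g (x - v)) / 2)"
    by (auto simp: field_simps)
  then show ?case using Cons by simp
qed simp

lemma sign_avg_cmult: "sign_avg vs (\<lambda>x. c * f x) = c * sign_avg vs f"
proof (induction vs arbitrary: f)
  case (Cons v vs)
  have "(\<lambda>x. (c * f (x + v) + c * f (x - v)) / 2) = (\<lambda>x. c * ((f (x + v) + f (x - v)) / 2))"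
    by (auto simp: field_simps)
  then show ?case by (simp only: sign_avg.simps Cons)
qed simp

lemma sign_avg_sum: "sign_avg vs (\<lambda>x. \<Sum>i\<in>I. f i x) = (\<Sum>i\<in>I. sign_avg vs (f i))"
proof (induction I rule: infinite_finite_induct)
  case (insert i I)
  then show ?case by (simp add: sign_avg_add)
qed (use sign_avg_cmult[of vs 0 "\<lambda>_. 0"] in simp_all)

lemma sign_avg_nonneg: "(\<And>x. 0 \<le> f x) \<Longrightarrow> 0 \<le> sign_avg vs f"
  by (induction vs arbitrary: f) auto

text \<open>The algebraic core of the Cauchy--Schwarz inequality, which is needed below both for averages
  over signs and for integrals.  If \<open>a \<noteq> 0\<close>, the form is evaluated at \<open>(- b, a)\<close>; if
  \<open>a = 0\<close>, at a point where it would be negative unless \<open>b = 0\<close>.\<close>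

lemma sq_le_mult_of_nonneg_form:
  fixes a b c :: real
  assumes "\<And>s t. 0 \<le> s\<^sup>2 * a + 2 * s * t * b + t\<^sup>2 * c"
  shows "b\<^sup>2 \<le> a * c"
proof (cases "a = 0")
  case True
  have "0 \<le> 2 * (- (c + 1)) * b * b + b\<^sup>2 * c"
    using assms[of "- (c + 1)" b] True by simp
  moreover have "0 \<le> c" using assms[of 0 1] by simp
  ultimately have "(c + 2) * b\<^sup>2 \<le> 0" by (simp add: power2_eq_square algebra_simps)
  with \<open>0 \<le> c\<close> have "b\<^sup>2 \<le> 0" by (simp add: mult_le_0_iff)
  with True show ?thesis by simp
next
  case False
  moreover have "0 \<le> a" using assms[of 1 0] by simp
  ultimately have "0 < a" by simp
  moreover have "0 \<le> a * (a * c - b\<^sup>2)"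
    using assms[of "- b" a] by (simp add: power2_eq_square algebra_simps)
  ultimately show ?thesis by (simp add: zero_le_mult_iff)
qed

lemma sign_avg_Cauchy_Schwarz:
  "(sign_avg vs (\<lambda>x. f x * g x))\<^sup>2 \<le> sign_avg vs (\<lambda>x. (f x)\<^sup>2) * sign_avg vs (\<lambda>x. (g x)\<^sup>2)"
proof (rule sq_le_mult_of_nonneg_form)
  fix s t :: real
  have "0 \<le> sign_avg vs (\<lambda>x. (s * f x + t * g x)\<^sup>2)"
    by (rule sign_avg_nonneg) simp
  also have "(\<lambda>x. (s * f x + t * g x)\<^sup>2) = (\<lambda>x. s\<^sup>2 * (f x)\<^sup>2 + ((2 * s * t) * (f x * g x) + t\<^sup>2 * (g x)\<^sup>2))"
    by (auto simp: power2_eq_square algebra_simps)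
  finally show "0 \<le> s\<^sup>2 * sign_avg vs (\<lambda>x. (f x)\<^sup>2) + 2 * s * t * sign_avg vs (\<lambda>x. f x * g x)
      + t\<^sup>2 * sign_avg vs (\<lambda>x. (g x)\<^sup>2)"
    by (simp only: sign_avg_add sign_avg_cmult add.assoc)
qed

text \<open>Conditionally on the other signs, the first sign \<open>\<epsilon>\<close> turns \<open>p\<close> into
  \<open>q + \<epsilon> r\<close>, where \<open>q\<close> is the mean and \<open>r\<close> the half difference of the two shifts of
  \<open>p\<close>.  Averaging over \<open>\<epsilon>\<close> gives \<open>E p\<^sup>2 = E q\<^sup>2 + E r\<^sup>2\<close> and
  \<open>E p\<^sup>4 = E q\<^sup>4 + 6 E (q\<^sup>2 r\<^sup>2) + E r\<^sup>4\<close>.  As \<open>r\<close> has smaller degree than \<open>p\<close>, the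
  induction hypothesis for \<open>r\<close> saves a factor \<open>9\<close>, hence a factor \<open>3\<close> in the
  Cauchy--Schwarz bound of the mixed term: \<open>6\<close> becomes \<open>2\<close>, and a complete square remains.\<close>

lemma sign_avg_hypercontractive:
  fixes p :: "real ^ 'n \<Rightarrow> real"
  assumes "p \<in> poly_funs D"
  shows "sign_avg vs (\<lambda>x. p x ^ 4) \<le> 9 ^ D * (sign_avg vs (\<lambda>x. (p x)\<^sup>2))\<^sup>2"
  using assms
proof (induction vs arbitrary: p D)
  case Nil
  have "1 * p 0 ^ 4 \<le> 9 ^ D * p 0 ^ 4" by (intro mult_right_mono) auto
  then show ?case by simp
next
  case (Cons v vs)
  define q where "q x = (p (x + v) + p (x - v)) / 2" for x
  define r where "r x = (p (x + v) - p (x - v)) / 2" for x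
  define a where "a = sign_avg vs (\<lambda>x. (q x)\<^sup>2)"
  define b where "b = sign_avg vs (\<lambda>x. (r x)\<^sup>2)"
  define m where "m = sign_avg vs (\<lambda>x. (q x)\<^sup>2 * (r x)\<^sup>2)"
  have nn: "0 \<le> a" "0 \<le> b" "0 \<le> m"
    unfolding a_def b_def m_def by (rule sign_avg_nonneg; simp)+
  have q: "sign_avg vs (\<lambda>x. q x ^ 4) \<le> 9 ^ D * a\<^sup>2"
    unfolding a_def q_def by (intro Cons.IH poly_funs_mean_shift Cons.prems)
  \<comment> \<open>In degree \<open>0\<close> there is nothing to save, but then \<open>r\<close> vanishes.\<close>
  have r: "9 * sign_avg vs (\<lambda>x. r x ^ 4) \<le> 9 ^ D * b\<^sup>2"
  proof (cases D)
    case 0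
    then have "r = (\<lambda>x. 0)"
      using poly_funs_half_difference[OF Cons.prems, of v] by (auto simp: r_def)
    then show ?thesis using sign_avg_cmult[of vs 0 "\<lambda>_. 0"] nn by simp
  next
    case (Suc E)
    then have "r \<in> poly_funs E"
      using poly_funs_half_difference[OF Cons.prems, of v] by (simp add: r_def[abs_def])
    from Cons.IH[OF this] show ?thesis by (simp add: Suc b_def)
  qed
  have "m\<^sup>2 \<le> sign_avg vs (\<lambda>x. q x ^ 4) * sign_avg vs (\<lambda>x. r x ^ 4)"
    unfolding m_def using sign_avg_Cauchy_Schwarz[of vs "\<lambda>x. (q x)\<^sup>2" "\<lambda>x. (r x)\<^sup>2"]
    by (simp flip: power_mult)
  then have "(3 * m)\<^sup>2 \<le> sign_avg vs (\<lambda>x. q x ^ 4) * (9 * sign_avg vs (\<lambda>x. r x ^ 4))"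
    by (simp add: power2_eq_square)
  also have "\<dots> \<le> (9 ^ D * a\<^sup>2) * (9 ^ D * b\<^sup>2)"
    by (intro mult_mono q r mult_nonneg_nonneg sign_avg_nonneg) auto
  also have "\<dots> = (9 ^ D * (a * b))\<^sup>2" by (simp add: power2_eq_square)
  finally have m: "3 * m \<le> 9 ^ D * (a * b)"
    by (rule power2_le_imp_le) (use nn in simp)
  have 4: "(p (x + v) ^ 4 + p (x - v) ^ 4) / 2 = q x ^ 4 + (6 * ((q x)\<^sup>2 * (r x)\<^sup>2) + r x ^ 4)" for x
  proof -
    have "((s + t) ^ 4 + (s - t) ^ 4) / 2 = s ^ 4 + (6 * (s\<^sup>2 * t\<^sup>2) + t ^ 4)" for s t :: real
      by (simp add: power2_eq_square power4_eq_xxxx algebra_simps)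
    from this[of "q x" "r x"] show ?thesis by (simp add: q_def r_def field_simps)
  qed
  have 2: "((p (x + v))\<^sup>2 + (p (x - v))\<^sup>2) / 2 = (q x)\<^sup>2 + (r x)\<^sup>2" for x
    by (simp add: q_def r_def power2_eq_square field_simps)
  have "sign_avg (v # vs) (\<lambda>x. p x ^ 4)
      = sign_avg vs (\<lambda>x. q x ^ 4) + (6 * m + sign_avg vs (\<lambda>x. r x ^ 4))"
    by (simp only: sign_avg.simps 4 sign_avg_add sign_avg_cmult m_def)
  also have "\<dots> \<le> 9 ^ D * a\<^sup>2 + (2 * (9 ^ D * (a * b)) + 9 ^ D * b\<^sup>2)"
  proof -
    have "0 \<le> sign_avg vs (\<lambda>x. r x ^ 4)" by (rule sign_avg_nonneg) simp
    with q r m show ?thesis by linarith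
  qed
  also have "\<dots> = 9 ^ D * (a + b)\<^sup>2" by (simp add: power2_eq_square algebra_simps)
  also have "a + b = sign_avg (v # vs) (\<lambda>x. (p x)\<^sup>2)"
    by (simp only: sign_avg.simps 2 sign_avg_add a_def b_def)
  finally show ?case .
qed

text \<open>Signs that are attached to different coordinate axes act on different factors, so the average
  of a product of functions of single coordinates factorises.  The pair \<open>(i, c)\<close> stands for the
  vector with entry \<open>c\<close> at \<open>i\<close> and \<open>0\<close> elsewhere.\<close>

lemma sign_avg_axis_prod:
  fixes g :: "'n::finite \<Rightarrow> real \<Rightarrow> real"
  shows "sign_avg (map (\<lambda>(i, c). axis i c) ws) (\<lambda>x. \<Prod>i\<in>UNIV. g i (x $ i))
    = (\<Prod>i\<in>UNIV. sign_avg (map snd (filter (\<lambda>w. fst w = i) ws)) (g i))"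
proof (induction ws arbitrary: g)
  case Nil
  show ?case by simp
next
  case (Cons w ws)
  obtain j c where w: "w = (j, c)" by force
  define h where "h i = (if i = j then (\<lambda>y. (g i (y + c) + g i (y - c)) / 2) else g i)" for i
  have split: "(\<Prod>i\<in>UNIV. f i) = f j * (\<Prod>i\<in>UNIV - {j}. f i)" for f :: "'n \<Rightarrow> real"
    by (rule prod.remove) auto
  have "(\<Prod>i\<in>UNIV. g i ((x + axis j t) $ i)) = g j (x $ j + t) * (\<Prod>i\<in>UNIV - {j}. g i (x $ i))" for x t
    by (subst split) (auto simp: axis_def intro!: prod.cong)
  moreover have "(\<Prod>i\<in>UNIV. g i ((x - axis j t) $ i)) = g j (x $ j - t) * (\<Prod>i\<in>UNIV - {j}. g i (x $ i))" for x t
    by (subst split) (auto simp: axis_def intro!: prod.cong)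
  moreover have "(\<Prod>i\<in>UNIV. h i (x $ i)) = (g j (x $ j + c) + g j (x $ j - c)) / 2 * (\<Prod>i\<in>UNIV - {j}. g i (x $ i))" for x
    by (subst split) (auto simp: h_def intro!: prod.cong)
  ultimately have "(\<lambda>x. ((\<Prod>i\<in>UNIV. g i ((x + axis j c) $ i)) + (\<Prod>i\<in>UNIV. g i ((x - axis j c) $ i))) / 2)
      = (\<lambda>x. \<Prod>i\<in>UNIV. h i (x $ i))"
    by (auto simp: algebra_simps add_divide_distrib)
  then have "sign_avg (map (\<lambda>(i, c). axis i c) (w # ws)) (\<lambda>x. \<Prod>i\<in>UNIV. g i (x $ i))
    = (\<Prod>i\<in>UNIV. sign_avg (map snd (filter (\<lambda>w. fst w = i) ws)) (h i))"
    using Cons.IH[of h] by (simp add: w)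
  also have "\<dots> = (\<Prod>i\<in>UNIV. sign_avg (map snd (filter (\<lambda>w. fst w = i) (w # ws))) (g i))"
    by (rule prod.cong) (auto simp: w h_def)
  finally show ?case .
qed

text \<open>A random vector whose coordinates are independent copies of \<open>c (\<epsilon>\<^sub>1 + \<dots> + \<epsilon>\<^sub>m)\<close> is itself
  a random signed sum of vectors.\<close>

lemma ex_independent_coordinate_signs:
  "\<exists>vs. \<forall>g :: 'n::finite \<Rightarrow> real \<Rightarrow> real. sign_avg vs (\<lambda>x :: real ^ 'n. \<Prod>i\<in>UNIV. g i (x $ i))
     = (\<Prod>i\<in>UNIV. sign_avg (replicate m c) (g i))"
proof -
  obtain js :: "'n list" where js: "set js = UNIV" "distinct js"
    using finite_distinct_list[of "UNIV :: 'n set"] by auto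
  define ws where "ws = concat (map (\<lambda>j. replicate m (j, c)) js)"
  have "map snd (filter (\<lambda>w. fst w = i) (concat (map (\<lambda>j. replicate m (j, c)) ks)))
      = (if i \<in> set ks then replicate m c else [])" if "distinct ks" for i and ks :: "'n list"
    using that by (induction ks) (auto simp: filter_replicate)
  then have "map snd (filter (\<lambda>w. fst w = i) ws) = replicate m c" for i
    using js by (simp add: ws_def)
  then show ?thesis using sign_avg_axis_prod[of ws] by (intro exI[of _ "map (\<lambda>(i, c). axis i c) ws"]) simp
qed

section \<open>Moments\<close>

text \<open>The discrete counterpart of Gaussian integration by parts.  Given the others, each of the
  \<open>m\<close> signs in the factor \<open>x\<close> turns \<open>g\<close> into its half difference in the step \<open>c\<close>.\<close>

lemma sign_avg_Stein:
  "sign_avg (replicate m c) (\<lambda>x. x * g x)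
     = real m * c * sign_avg (replicate (m - 1) c) (\<lambda>x. (g (x + c) - g (x - c)) / 2)"
proof (induction m arbitrary: g)
  case (Suc m)
  define A where "A x = (g (x + c) + g (x - c)) / 2" for x
  define \<Delta> where "\<Delta> x = (g (x + c) - g (x - c)) / 2" for x
  have eq: "((x + c) * g (x + c) + (x - c) * g (x - c)) / 2 = x * A x + c * \<Delta> x" for x
    by (simp add: A_def \<Delta>_def field_simps)
  have "sign_avg (replicate (Suc m) c) (\<lambda>x. x * g x)
      = sign_avg (replicate m c) (\<lambda>x. x * A x) + c * sign_avg (replicate m c) \<Delta>"
    by (simp only: replicate_Suc sign_avg.simps eq sign_avg_add sign_avg_cmult)
  also have "sign_avg (replicate m c) (\<lambda>x. x * A x) = real m * c * sign_avg (replicate m c) \<Delta>"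
  proof (cases m)
    case (Suc k)
    have eq: "(A (x + c) - A (x - c)) / 2 = (\<Delta> (x + c) + \<Delta> (x - c)) / 2" for x
      by (simp add: A_def \<Delta>_def field_simps)
    have "sign_avg (replicate (m - 1) c) (\<lambda>x. (A (x + c) - A (x - c)) / 2) = sign_avg (replicate m c) \<Delta>"
      by (simp only: eq) (simp add: Suc)
    then show ?thesis using Suc.IH[of A] by simp
  qed (simp add: Suc.IH)
  finally show ?case by (simp add: \<Delta>_def[abs_def] algebra_simps)
qed simp

lemma sign_avg_replicate_scale:
  "sign_avg (replicate m (c * a)) f = sign_avg (replicate m a) (\<lambda>x::real. f (c * x))"
  by (induction m arbitrary: f) (simp_all add: distrib_left right_diff_distrib)

text \<open>The moments of the standard normal distribution, by the recursion that integration by parts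
  yields.  The same recursion appears in the limit for normalised sums of signs.\<close>

fun gauss_moment :: "nat \<Rightarrow> real" where
  "gauss_moment 0 = 1"
| "gauss_moment (Suc 0) = 0"
| "gauss_moment (Suc (Suc r)) = real (Suc r) * gauss_moment r"

lemma sign_sum_moment_Suc:
  "sign_avg (replicate (Suc m) 1) (\<lambda>x::real. x ^ Suc r)
   = real (Suc m) * (\<Sum>j\<le>r. real (r choose j) * ((1 - (- 1) ^ j) / 2) * sign_avg (replicate m 1) (\<lambda>x. x ^ (r - j)))"
proof -
  have "((x + 1) ^ r - (x - 1) ^ r) / 2
      = (\<Sum>j\<le>r. (real (r choose j) * ((1 - (- 1) ^ j) / 2)) * x ^ (r - j))" for x :: real
  proof -
    have "(x + 1) ^ r = (\<Sum>j\<le>r. real (r choose j) * x ^ (r - j))"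
      using binomial_ring[of 1 x r] by (simp add: add.commute)
    moreover have "(x - 1) ^ r = (\<Sum>j\<le>r. real (r choose j) * (- 1) ^ j * x ^ (r - j))"
      using binomial_ring[of "- 1" x r] by simp
    ultimately show ?thesis
      by (simp add: sum_subtractf[symmetric] sum_divide_distrib) (auto intro!: sum.cong simp: field_simps)
  qed
  then show ?thesis
    using sign_avg_Stein[of "Suc m" 1 "\<lambda>x. x ^ r"]
    by (simp only: power_Suc sign_avg_sum sign_avg_cmult) simp
qed

text \<open>The central limit theorem at the level of moments.  After normalisation by
  \<open>sqrt m\<close>, the \<open>j\<close>-th term of the recursion for sums of signs carries a factor of order
  \<open>m\<close> to the power \<open>(1 - j) / 2\<close>, and the terms with even \<open>j\<close> vanish.  Only
  \<open>j = 1\<close> survives in the limit, and what is left is the Gaussian recursion.\<close>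

lemma sign_sum_moment_tendsto:
  "(\<lambda>m. sign_avg (replicate m (1 / sqrt (real m))) (\<lambda>x::real. x ^ r)) \<longlonglongrightarrow> gauss_moment r"
proof (induction r rule: less_induct)
  case (less r)
  define u where "u r m = sign_avg (replicate m 1) (\<lambda>x::real. x ^ r)" for r m
  have U: "sign_avg (replicate m (1 / sqrt (real m))) (\<lambda>x::real. x ^ r) = u r m / sqrt (real m) ^ r" for r m
  proof -
    have "(1 / sqrt (real m) * x) ^ r = (1 / sqrt (real m) ^ r) * x ^ r" for x
      by (simp add: power_divide)
    then show ?thesis
      using sign_avg_replicate_scale[of m "1 / sqrt (real m)" 1 "\<lambda>x. x ^ r"]
      by (simp add: sign_avg_cmult[of _ "1 / sqrt (real m) ^ r", simplified] u_def)
  qed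
  show ?case
  proof (cases r)
    case 0
    have "sign_avg vs (\<lambda>x::real. 1) = 1" for vs by (induction vs) auto
    then show ?thesis by (simp add: 0)
  next
    case (Suc s)
    define w where "w j = real (s choose j) * ((1 - (- 1) ^ j) / 2)" for j
    have "(\<lambda>m. \<Sum>j\<le>s. w j * ((u (s - j) m / sqrt (real m) ^ (s - j)) *
              ((sqrt (real m) / sqrt (real (Suc m))) ^ (s - j) * (1 / sqrt (real (Suc m))) ^ (j - 1))))
        \<longlonglongrightarrow> (\<Sum>j\<le>s. w j * (gauss_moment (s - j) * (1 ^ (s - j) * 0 ^ (j - 1))))"
    proof (intro tendsto_sum tendsto_mult tendsto_power tendsto_const)
      show "(\<lambda>m. u (s - j) m / sqrt (real m) ^ (s - j)) \<longlonglongrightarrow> gauss_moment (s - j)" for j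
        using less[of "s - j"] by (simp add: Suc U)
      show "(\<lambda>m. sqrt (real m) / sqrt (real (Suc m))) \<longlonglongrightarrow> 1" by real_asymp
      show "(\<lambda>m. 1 / sqrt (real (Suc m))) \<longlonglongrightarrow> 0" by real_asymp
    qed
    also have "(\<Sum>j\<le>s. w j * (gauss_moment (s - j) * (1 ^ (s - j) * 0 ^ (j - 1)))) = gauss_moment r"
    proof (cases s)
      case 0
      then show ?thesis by (simp add: Suc w_def)
    next
      case (Suc q)
      have "(\<Sum>j\<le>s. w j * (gauss_moment (s - j) * (1 ^ (s - j) * 0 ^ (j - 1))))
          = (\<Sum>j\<le>s. if j = 1 then w 1 * gauss_moment (s - 1) else 0)"
        by (rule sum.cong) (auto simp: w_def power_0_left le_Suc_eq)
      then show ?thesis using Suc by (simp add: w_def \<open>r = Suc s\<close>)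
    qed
    finally have "(\<lambda>m. \<Sum>j\<le>s. w j * ((u (s - j) m / sqrt (real m) ^ (s - j)) *
              ((sqrt (real m) / sqrt (real (Suc m))) ^ (s - j) * (1 / sqrt (real (Suc m))) ^ (j - 1))))
        \<longlonglongrightarrow> gauss_moment r" .
    moreover have "eventually (\<lambda>m. (\<Sum>j\<le>s. w j * ((u (s - j) m / sqrt (real m) ^ (s - j)) *
              ((sqrt (real m) / sqrt (real (Suc m))) ^ (s - j) * (1 / sqrt (real (Suc m))) ^ (j - 1))))
        = u r (Suc m) / sqrt (real (Suc m)) ^ r) sequentially"
      using eventually_gt_at_top[of 0]
    proof eventually_elim
      case (elim m)
      define S T where "S = sqrt (real m)" and "T = sqrt (real (Suc m))"
      have ST: "S \<noteq> 0" "T \<noteq> 0" and T2: "real (Suc m) = T\<^sup>2" using elim by (auto simp: S_def T_def)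
      have "w j * ((u (s - j) m / S ^ (s - j)) * ((S / T) ^ (s - j) * (1 / T) ^ (j - 1)))
          = T\<^sup>2 * (w j * u (s - j) m) / T ^ r" if "j \<le> s" for j
      proof (cases "j = 0")
        case True
        then show ?thesis by (simp add: w_def)
      next
        case False
        with that have "r = (s - j) + (j - 1) + 2" using \<open>r = Suc s\<close> by simp
        then have "T ^ r = T ^ (s - j) * T ^ (j - 1) * T\<^sup>2" by (simp only: power_add)
        then show ?thesis using ST by (simp add: power_divide)
      qed
      then have "(\<Sum>j\<le>s. w j * ((u (s - j) m / S ^ (s - j)) * ((S / T) ^ (s - j) * (1 / T) ^ (j - 1))))
         = T\<^sup>2 * (\<Sum>j\<le>s. w j * u (s - j) m) / T ^ r"
        by (simp add: sum_distrib_left sum_divide_distrib)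
      also have "T\<^sup>2 * (\<Sum>j\<le>s. w j * u (s - j) m) = u r (Suc m)"
        using sign_sum_moment_Suc[of m s] by (simp only: u_def w_def Suc T2)
      finally show ?case by (simp only: S_def T_def)
    qed
    ultimately have "(\<lambda>m. u r (Suc m) / sqrt (real (Suc m)) ^ r) \<longlonglongrightarrow> gauss_moment r"
      by (rule Lim_transform_eventually)
    then have "(\<lambda>m. u r m / sqrt (real m) ^ r) \<longlonglongrightarrow> gauss_moment r"
      by (rule LIMSEQ_imp_Suc)
    then show ?thesis by (simp add: U)
  qed
qed

lemma gauss_moment_even: "gauss_moment (2 * k) = fact (2 * k) / (2 ^ k * fact k)"
proof (induction k)
  case (Suc k)
  have eq: "fact (2 * Suc k) = 2 * real (Suc k) * (real (2 * k + 1) * fact (2 * k))"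
    by (simp add: algebra_simps)
  have "fact (2 * Suc k) / (2 ^ Suc k * fact (Suc k) :: real)
      = (2 * real (Suc k)) * (real (2 * k + 1) * fact (2 * k)) / ((2 * real (Suc k)) * (2 ^ k * fact k))"
    unfolding eq by (simp only: power_Suc fact_Suc of_nat_mult ac_simps)
  also have "\<dots> = real (2 * k + 1) * fact (2 * k) / (2 ^ k * fact k)"
    by (rule mult_divide_mult_cancel_left) simp
  finally show ?case by (simp add: Suc)
qed simp

lemma gauss_moment_odd: "gauss_moment (2 * k + 1) = 0"
  by (induction k) simp_all

lemma std_normal_law_moment:
  "integrable std_normal_law (\<lambda>x. x ^ r)" "(\<integral>x. x ^ r \<partial>std_normal_law) = gauss_moment r"
proof -
  show "integrable std_normal_law (\<lambda>x. x ^ r)"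
    unfolding std_normal_law_def
    using integrable_std_normal_moment[of r] by (subst integrable_density) auto
  have "(\<integral>x. x ^ r \<partial>std_normal_law) = (\<integral>x. std_normal_density x * x ^ r \<partial>lborel)"
    unfolding std_normal_law_def by (subst integral_density) auto
  also have "\<dots> = gauss_moment r"
  proof (cases "even r")
    case True
    then obtain k where "r = 2 * k" by (elim evenE)
    then show ?thesis by (simp only: integral_std_normal_moment_even gauss_moment_even)
  next
    case False
    then obtain k where "r = 2 * k + 1" by (elim oddE)
    then show ?thesis by (simp only: integral_std_normal_moment_odd gauss_moment_odd)
  qed
  finally show "(\<integral>x. x ^ r \<partial>std_normal_law) = gauss_moment r" .
qed

lemma rademacher_law_moment:
  "integrable rademacher_law (\<lambda>x. x ^ r)"
  "(\<integral>x. x ^ r \<partial>rademacher_law) = sign_avg (replicate 1 1) (\<lambda>x. x ^ r)"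
proof -
  have "integrable (measure_pmf (pmf_of_set {- 1, 1 :: real})) (\<lambda>x. x ^ r)"
    by (rule integrable_measure_pmf_finite) simp
  then show "integrable rademacher_law (\<lambda>x. x ^ r)"
    unfolding rademacher_law_def by (subst integrable_distr_eq) auto
  have "(\<integral>x. x ^ r \<partial>rademacher_law) = measure_pmf.expectation (pmf_of_set {- 1, 1 :: real}) (\<lambda>x. x ^ r)"
    unfolding rademacher_law_def by (subst integral_distr) auto
  also have "\<dots> = sign_avg (replicate 1 1) (\<lambda>x. x ^ r)"
    by (subst integral_pmf_of_set) auto
  finally show "(\<integral>x. x ^ r \<partial>rademacher_law) = sign_avg (replicate 1 1) (\<lambda>x. x ^ r)" .
qed

lemma sets_iid_law [measurable_cong]: "sets (iid_law \<mu> :: (real ^ 'n) measure) = sets borel"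
  by (simp add: iid_law_def)

lemma iid_law_monomial:
  fixes a :: "'n::finite \<Rightarrow> nat"
  assumes "prob_space \<mu>" and sets: "sets \<mu> = sets borel" and int: "\<And>r. integrable \<mu> (\<lambda>x. x ^ r)"
  shows "integrable (iid_law \<mu>) (monomial_fun a)"
    and "(\<integral>x. monomial_fun a x \<partial>iid_law \<mu>) = (\<Prod>i\<in>UNIV. \<integral>x. x ^ a i \<partial>\<mu>)"
proof -
  interpret product_prob_space "\<lambda>_ :: 'n. \<mu>" UNIV
    by (simp add: assms(1) product_prob_spaceI)
  have meas: "monomial_fun a \<in> borel_measurable borel"
    unfolding monomial_fun_def by (intro borel_measurable_continuous_onI continuous_intros)
  have eq: "monomial_fun a (\<chi> i. f i) = (\<Prod>i\<in>UNIV. f i ^ a i)" for f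
    by (simp add: monomial_fun_def)
  show "integrable (iid_law \<mu>) (monomial_fun a)"
    unfolding iid_law_def using measurable_vec_of_fun[OF sets] meas
    by (subst integrable_distr_eq) (auto simp: eq intro!: product_integrable_prod int)
  show "(\<integral>x. monomial_fun a x \<partial>iid_law \<mu>) = (\<Prod>i\<in>UNIV. \<integral>x. x ^ a i \<partial>\<mu>)"
    unfolding iid_law_def using measurable_vec_of_fun[OF sets] meas
    by (subst integral_distr) (auto simp: eq intro!: product_integral_prod int)
qed

section \<open>Hypercontractivity\<close>

text \<open>Gaussian and Rademacher vectors are treated alike: all their mixed moments are limits of those
  of random signed sums.  An inequality between expectations of polynomials that holds for all
  signed sums therefore passes to \<open>Q\<close>.\<close>

locale moment_limit_of_signs =
  fixes Q :: "(real ^ 'n) measure" and vs :: "nat \<Rightarrow> (real ^ 'n) list"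
  assumes prob: "prob_space Q" and sets [measurable_cong]: "sets Q = sets borel"
    and integrable_monomial: "\<And>a. integrable Q (monomial_fun a)"
    and moment_limit: "\<And>a. (\<lambda>m. sign_avg (vs m) (monomial_fun a)) \<longlonglongrightarrow> (\<integral>x. monomial_fun a x \<partial>Q)"
begin

lemma integrable_poly: "p \<in> poly_funs D \<Longrightarrow> integrable Q p"
  by (induction rule: poly_funs_monomial_induct) (auto intro: integrable_monomial)

lemma poly_limit: "p \<in> poly_funs D \<Longrightarrow> (\<lambda>m. sign_avg (vs m) p) \<longlonglongrightarrow> (\<integral>x. p x \<partial>Q)"
proof (induction rule: poly_funs_monomial_induct)
  case (monomial c a)
  have "(\<lambda>m. c * sign_avg (vs m) (monomial_fun a)) \<longlonglongrightarrow> c * (\<integral>x. monomial_fun a x \<partial>Q)"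
    by (intro tendsto_mult_left moment_limit)
  then show ?case by (simp add: sign_avg_cmult)
next
  case (add p q)
  then show ?case
    using tendsto_add[OF add.IH] integrable_poly by (simp add: sign_avg_add)
qed

lemma hypercontractive:
  assumes "p \<in> poly_funs D"
  shows "(\<integral>x. p x ^ 4 \<partial>Q) \<le> 9 ^ D * (\<integral>x. (p x)\<^sup>2 \<partial>Q)\<^sup>2"
proof (rule LIMSEQ_le)
  show "(\<lambda>m. sign_avg (vs m) (\<lambda>x. p x ^ 4)) \<longlonglongrightarrow> (\<integral>x. p x ^ 4 \<partial>Q)"
    by (rule poly_limit[OF poly_funs_power[OF assms]])
  show "(\<lambda>m. 9 ^ D * (sign_avg (vs m) (\<lambda>x. (p x)\<^sup>2))\<^sup>2) \<longlonglongrightarrow> 9 ^ D * (\<integral>x. (p x)\<^sup>2 \<partial>Q)\<^sup>2"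
    by (intro tendsto_intros poly_limit[OF poly_funs_power[OF assms]])
  show "\<exists>N. \<forall>n\<ge>N. sign_avg (vs n) (\<lambda>x. p x ^ 4) \<le> 9 ^ D * (sign_avg (vs n) (\<lambda>x. (p x)\<^sup>2))\<^sup>2"
    using sign_avg_hypercontractive[OF assms] by blast
qed

end

text \<open>Moments of product laws are products of moments, so it is enough to approximate the law of a
  single entry.\<close>

lemma iid_law_moment_limit_of_signs:
  assumes \<mu>: "prob_space \<mu>" "sets \<mu> = sets borel" "\<And>r. integrable \<mu> (\<lambda>x. x ^ r)"
    and lim: "\<And>r. (\<lambda>m. sign_avg (replicate (k m) (c m)) (\<lambda>x. x ^ r)) \<longlonglongrightarrow> (\<integral>x. x ^ r \<partial>\<mu>)"
  shows "\<exists>vs. moment_limit_of_signs (iid_law \<mu> :: (real ^ 'n) measure) vs"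
proof -
  have "\<exists>vs. \<forall>m. \<forall>g :: 'n \<Rightarrow> real \<Rightarrow> real. sign_avg (vs m) (\<lambda>x :: real ^ 'n. \<Prod>i\<in>UNIV. g i (x $ i))
     = (\<Prod>i\<in>UNIV. sign_avg (replicate (k m) (c m)) (g i))"
    by (rule choice) (intro allI ex_independent_coordinate_signs)
  then obtain vs where vs: "\<And>m (g :: 'n \<Rightarrow> real \<Rightarrow> real). sign_avg (vs m) (\<lambda>x :: real ^ 'n. \<Prod>i\<in>UNIV. g i (x $ i))
     = (\<Prod>i\<in>UNIV. sign_avg (replicate (k m) (c m)) (g i))"
    by blast
  have "(\<lambda>m. sign_avg (vs m) (monomial_fun a)) \<longlonglongrightarrow> (\<integral>x. monomial_fun a x \<partial>iid_law \<mu>)" for a :: "'n \<Rightarrow> nat"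
  proof -
    have eq: "sign_avg (vs m) (monomial_fun a) = (\<Prod>i\<in>UNIV. sign_avg (replicate (k m) (c m)) (\<lambda>x. x ^ a i))" for m
      unfolding monomial_fun_def[abs_def] by (rule vs)
    show ?thesis unfolding iid_law_monomial(2)[OF \<mu>] eq by (intro tendsto_prod lim)
  qed
  then show ?thesis
    using \<mu> by (intro exI[of _ vs] moment_limit_of_signs.intro prob_space_iid_law sets_iid_law iid_law_monomial)
qed

lemma gaussian_or_rademacher_moment_limit_of_signs:
  fixes Q :: "(real ^ 'n) measure"
  assumes "Q = iid_law std_normal_law \<or> Q = iid_law rademacher_law"
  shows "\<exists>vs. moment_limit_of_signs Q vs"
  using assms
proof
  assume "Q = iid_law std_normal_law"
  moreover have "sets std_normal_law = sets borel" by (simp add: std_normal_law_def)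
  ultimately show ?thesis
    using iid_law_moment_limit_of_signs[of std_normal_law "\<lambda>m. m" "\<lambda>m. 1 / sqrt (real m)"]
    by (simp add: prob_space_std_normal_law std_normal_law_moment sign_sum_moment_tendsto)
next
  assume "Q = iid_law rademacher_law"
  moreover have "sets rademacher_law = sets borel" by (simp add: rademacher_law_def)
  ultimately show ?thesis
    using iid_law_moment_limit_of_signs[of rademacher_law "\<lambda>m. 1" "\<lambda>m. 1"]
    by (simp add: prob_space_rademacher_law rademacher_law_moment del: replicate.simps)
qed

section \<open>Powers of symmetric matrices\<close>

text \<open>Powers for the matrix product.  The overloaded power notation on vectors would be taken
  entrywise.\<close>

primrec mat_pow :: "real ^ 'l ^ 'l \<Rightarrow> nat \<Rightarrow> real ^ 'l ^ 'l" where
  "mat_pow A 0 = mat 1"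
| "mat_pow A (Suc k) = A ** mat_pow A k"

lemma mat_pow_vector: "mat_pow A k *v v = ((*v) A ^^ k) v"
  by (induction k) (simp_all add: matrix_vector_mul_assoc[symmetric])

text \<open>The norm of the type of matrices is the Frobenius norm.\<close>

lemma sum_sq_entries: "(norm (A :: real ^ 'm ^ 'n))\<^sup>2 = (\<Sum>i\<in>UNIV. \<Sum>j\<in>UNIV. (A $ i $ j)\<^sup>2)"
proof -
  have "(norm A)\<^sup>2 = (\<Sum>i\<in>UNIV. (norm (A $ i))\<^sup>2)"
    by (simp add: norm_vec_def L2_set_def sum_nonneg)
  also have "\<dots> = (\<Sum>i\<in>UNIV. \<Sum>j\<in>UNIV. (A $ i $ j)\<^sup>2)"
    by (simp add: norm_vec_def[of "A $ _"] L2_set_def sum_nonneg)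
  finally show ?thesis .
qed

lemma norm_matrix_vector_le: "norm ((A :: real ^ 'm ^ 'n) *v v) \<le> norm A * norm v"
proof -
  have "(norm (A *v v))\<^sup>2 = (\<Sum>i\<in>UNIV. (A $ i \<bullet> v)\<^sup>2)"
    by (simp add: norm_vec_def L2_set_def sum_nonneg matrix_vector_mul_component)
  also have "\<dots> \<le> (\<Sum>i\<in>UNIV. (norm (A $ i) * norm v)\<^sup>2)"
    by (intro sum_mono) (metis Cauchy_Schwarz_ineq2 abs_ge_zero power2_abs power_mono)
  also have "\<dots> = (norm A)\<^sup>2 * (norm v)\<^sup>2"
    by (simp add: norm_vec_def[of A] L2_set_def sum_nonneg power_mult_distrib sum_distrib_right)
  finally have "(norm (A *v v))\<^sup>2 \<le> (norm A * norm v)\<^sup>2" by (simp add: power_mult_distrib)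
  then show ?thesis by (rule power2_le_imp_le) simp
qed

lemma Frobenius_norm_le:
  assumes "0 \<le> c" "\<And>v. norm (A *v v) \<le> c * norm v"
  shows "(norm (A :: real ^ 'l ^ 'l))\<^sup>2 \<le> real CARD('l) * c\<^sup>2"
proof -
  have "(norm A)\<^sup>2 = (\<Sum>j\<in>UNIV. \<Sum>i\<in>UNIV. (A $ i $ j)\<^sup>2)"
    unfolding sum_sq_entries by (rule sum.swap)
  also have "\<dots> = (\<Sum>j\<in>UNIV. (norm (A *v axis j 1))\<^sup>2)"
    by (simp add: norm_vec_def L2_set_def sum_nonneg matrix_vector_mult_basis column_def)
  also have "\<dots> \<le> (\<Sum>j\<in>(UNIV::'l set). c\<^sup>2)"
  proof (intro sum_mono power_mono norm_ge_zero)
    show "norm (A *v axis j 1) \<le> c" for j using assms(2)[of "axis j 1"] by simp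
  qed
  finally show ?thesis by simp
qed

lemma op_norm_ge_0: "0 \<le> op_norm A"
  unfolding op_norm_def by (intro onorm_pos_le matrix_vector_mul_bounded_linear)

lemma norm_mult_le_op_norm: "norm (A *v v) \<le> op_norm A * norm v"
  unfolding op_norm_def by (rule onorm[OF matrix_vector_mul_bounded_linear])

lemma norm_funpow_le_op_norm: "norm (((*v) A ^^ k) v) \<le> op_norm A ^ k * norm v"
proof (induction k)
  case (Suc k)
  have "norm (((*v) A ^^ Suc k) v) \<le> op_norm A * norm (((*v) A ^^ k) v)"
    by (simp add: norm_mult_le_op_norm)
  also have "\<dots> \<le> op_norm A * (op_norm A ^ k * norm v)"
    by (intro mult_left_mono Suc op_norm_ge_0)
  finally show ?case by (simp add: mult.assoc)
qed simp

text \<open>By symmetry and Cauchy--Schwarz, the norms \<open>b\<^sub>j\<close> of the iterates \<open>A\<^sup>j v\<close> are log-convex: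
  \<open>b\<^sub>j\<^sub>+\<^sub>1\<^sup>2 = \<langle>A\<^sup>j v, A\<^sup>j\<^sup>+\<^sup>2 v\<rangle> \<le> b\<^sub>j b\<^sub>j\<^sub>+\<^sub>2\<close>.  So their ratios increase, and each is at least
  the first one.  This replaces diagonalisation.\<close>

lemma norm_funpow_ge:
  assumes sym: "transpose A = (A :: real ^ 'l ^ 'l)" and v: "norm v = 1"
  shows "norm (A *v v) ^ k \<le> norm (((*v) A ^^ k) v)"
proof -
  define b where "b j = norm (((*v) A ^^ j) v)" for j
  have log_convex: "(b (Suc j))\<^sup>2 \<le> b j * b (Suc (Suc j))" for j
  proof -
    define x where "x = ((*v) A ^^ j) v"
    have "(b (Suc j))\<^sup>2 = (A *v x) \<bullet> (A *v x)" by (simp add: b_def x_def power2_norm_eq_inner)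
    also have "\<dots> = x \<bullet> (A *v (A *v x))"
      using dot_lmul_matrix[of x A "A *v x"] sym transpose_matrix_vector[of A x] by simp
    also have "\<dots> \<le> norm x * norm (A *v (A *v x))" by (rule norm_cauchy_schwarz)
    finally show ?thesis by (simp add: b_def x_def)
  qed
  have step: "b j * b 1 \<le> b (Suc j)" for j
  proof (induction j)
    case 0
    show ?case by (simp add: b_def v)
  next
    case (Suc j)
    have nn: "0 \<le> b i" for i by (simp add: b_def)
    show ?case
    proof (cases "b j = 0")
      case True
      then show ?thesis using log_convex[of j] nn by simp
    next
      case False
      have "b j * (b (Suc j) * b 1) \<le> b (Suc j) * b (Suc j)"
        using mult_left_mono[OF Suc nn[of "Suc j"]] by (simp add: ac_simps)
      also have "\<dots> \<le> b j * b (Suc (Suc j))" using log_convex[of j] by (simp add: power2_eq_square)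
      finally show ?thesis using False nn[of j] by (simp add: mult_le_cancel_left)
    qed
  qed
  have "b 1 ^ k \<le> b k"
  proof (induction k)
    case 0
    show ?case by (simp add: b_def v)
  next
    case (Suc k)
    have "b 1 ^ Suc k \<le> b k * b 1" using mult_right_mono[OF Suc, of "b 1"] by (simp add: b_def mult.commute)
    with step[of k] show ?case by simp
  qed
  then show ?thesis by (simp add: b_def)
qed

lemma norm_mat_pow_le: "(norm (mat_pow A k))\<^sup>2 \<le> real CARD('l) * op_norm A ^ (2 * k)" for A :: "real ^ 'l ^ 'l"
proof -
  have "(norm (mat_pow A k))\<^sup>2 \<le> real CARD('l) * (op_norm A ^ k)\<^sup>2"
    by (rule Frobenius_norm_le) (simp_all add: op_norm_ge_0 mat_pow_vector norm_funpow_le_op_norm)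
  then show ?thesis by (simp add: power_mult[symmetric] mult.commute)
qed

text \<open>For symmetric \<open>A\<close> the squared Frobenius norm of \<open>A\<^sup>k\<close> is the trace of \<open>A\<^sup>2\<^sup>k\<close>, the sum
  of the \<open>2k\<close>-th powers of the eigenvalues, one of which has modulus \<open>op_norm A\<close>.  The proof compares both sides on
  unit vectors, by the growth of the iterates.\<close>

lemma norm_mat_pow_ge:
  assumes "transpose A = (A :: real ^ 'l ^ 'l)"
  shows "op_norm A ^ (2 * k) \<le> (norm (mat_pow A k))\<^sup>2"
proof (cases "k = 0")
  case True
  have "1 \<le> (norm (mat_pow A 0 *v axis undefined 1))\<^sup>2" by simp
  also have "\<dots> \<le> (norm (mat_pow A 0))\<^sup>2"
    using norm_matrix_vector_le[of "mat_pow A 0" "axis undefined 1"] by (intro power_mono) auto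
  finally show ?thesis using True by simp
next
  case False
  define r where "r = root k (norm (mat_pow A k))"
  have r: "0 \<le> r" "r ^ k = norm (mat_pow A k)" using False by (auto simp: r_def)
  have "norm (A *v v) \<le> r * norm v" for v
  proof (cases "v = 0")
    case False
    define u where "u = v /\<^sub>R norm v"
    have u: "norm u = 1" "v = norm v *\<^sub>R u" using False by (auto simp: u_def)
    have "norm (A *v u) ^ k \<le> norm (mat_pow A k *v u)"
      unfolding mat_pow_vector by (rule norm_funpow_ge[OF assms u(1)])
    also have "\<dots> \<le> r ^ k" using norm_matrix_vector_le[of "mat_pow A k" u] by (simp add: r u)
    finally have "norm (A *v u) \<le> r" using \<open>k \<noteq> 0\<close> r(1) by (simp add: power_mono_iff del: r)
    then have "norm v * norm (A *v u) \<le> norm v * r" by (rule mult_left_mono) simp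
    moreover have "norm (A *v v) = norm v * norm (A *v u)"
      by (subst u(2)) (simp add: scaleR_matrix_vector_assoc[symmetric] matrix_vector_mult_scaleR)
    ultimately show ?thesis by (simp add: mult.commute)
  qed simp
  then have "op_norm A \<le> r" unfolding op_norm_def by (rule onorm_le)
  then have "op_norm A ^ (2 * k) \<le> r ^ (2 * k)" by (intro power_mono op_norm_ge_0)
  then show ?thesis by (simp add: power_mult mult.commute[of 2 k] r)
qed

lemma poly_funs_mat_pow:
  fixes M :: "real ^ 'n \<Rightarrow> real ^ 'l ^ 'l"
  assumes "\<And>i j. (\<lambda>y. M y $ i $ j) \<in> poly_funs d"
  shows "(\<lambda>y. mat_pow (M y) k $ i $ j) \<in> poly_funs (k * d)"
proof (induction k arbitrary: i j)
  case 0
  show ?case by (simp add: mat_def poly_funs_const)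
next
  case (Suc k)
  show ?case
    using poly_funs_sum[of UNIV "\<lambda>l y. M y $ i $ l * mat_pow (M y) k $ l $ j" "d + k * d"]
      poly_funs_mult[OF assms Suc]
    by (simp add: matrix_matrix_mult_def)
qed

lemma poly_funs_norm_mat_pow:
  fixes M :: "real ^ 'n \<Rightarrow> real ^ 'l ^ 'l"
  assumes "\<And>i j. (\<lambda>y. M y $ i $ j) \<in> poly_funs d"
  shows "(\<lambda>y. (norm (mat_pow (M y) k))\<^sup>2) \<in> poly_funs (2 * k * d)"
  unfolding sum_sq_entries
  using poly_funs_power[OF poly_funs_mat_pow[OF assms], where n = 2] by (intro poly_funs_sum) (simp add: mult.assoc)

section \<open>Square-integrable functions and low-degree projection\<close>

definition sq_integrable :: "'a measure \<Rightarrow> ('a \<Rightarrow> real) \<Rightarrow> bool" where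
  "sq_integrable Q f \<longleftrightarrow> f \<in> borel_measurable Q \<and> integrable Q (\<lambda>y. (f y)\<^sup>2)"

lemma sq_integrable_mult:
  assumes "sq_integrable Q f" "sq_integrable Q g"
  shows "integrable Q (\<lambda>y. f y * g y)"
proof (rule Bochner_Integration.integrable_bound)
  show "integrable Q (\<lambda>y. (f y)\<^sup>2 + (g y)\<^sup>2)"
    using assms by (simp add: sq_integrable_def)
  show "(\<lambda>y. f y * g y) \<in> borel_measurable Q"
    using assms by (auto simp: sq_integrable_def)
  have "\<bar>a * b\<bar> \<le> a\<^sup>2 + b\<^sup>2" for a b :: real
    using sum_squares_bound[of "\<bar>a\<bar>" "\<bar>b\<bar>"] mult_nonneg_nonneg[OF abs_ge_zero[of a] abs_ge_zero[of b]]
    unfolding abs_mult power2_abs by linarith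
  then show "AE y in Q. norm (f y * g y) \<le> norm ((f y)\<^sup>2 + (g y)\<^sup>2)" by simp
qed

lemma sq_integrable_cmult: "sq_integrable Q f \<Longrightarrow> sq_integrable Q (\<lambda>y. c * f y)"
  by (auto simp: sq_integrable_def power_mult_distrib)

lemma sq_integrable_add:
  assumes "sq_integrable Q f" "sq_integrable Q g"
  shows "sq_integrable Q (\<lambda>y. f y + g y)"
proof -
  have "(f y + g y)\<^sup>2 = (f y)\<^sup>2 + (g y)\<^sup>2 + 2 * (f y * g y)" for y by (simp add: power2_sum)
  then show ?thesis using assms sq_integrable_mult[OF assms] by (auto simp: sq_integrable_def)
qed

lemma sq_integrable_diff:
  assumes "sq_integrable Q f" "sq_integrable Q g"
  shows "sq_integrable Q (\<lambda>y. f y - g y)"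
  using sq_integrable_add[OF assms(1) sq_integrable_cmult[OF assms(2), of "- 1"]] by simp

lemma sq_integrable_sum:
  "(\<And>i. i \<in> I \<Longrightarrow> sq_integrable Q (f i)) \<Longrightarrow> sq_integrable Q (\<lambda>y. \<Sum>i\<in>I. f i y)"
  by (induction I rule: infinite_finite_induct) (auto intro: sq_integrable_add simp: sq_integrable_def[of _ "\<lambda>_. 0"])

lemma L2_inner_commute: "L2_inner Q f g = L2_inner Q g f"
  by (simp add: L2_inner_def mult.commute)

lemma L2_inner_cmult: "L2_inner Q (\<lambda>y. c * f y) g = c * L2_inner Q f g"
  by (simp add: L2_inner_def mult.assoc)

lemma L2_inner_add:
  "sq_integrable Q f \<Longrightarrow> sq_integrable Q g \<Longrightarrow> sq_integrable Q h \<Longrightarrow>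
     L2_inner Q (\<lambda>y. f y + g y) h = L2_inner Q f h + L2_inner Q g h"
  by (simp add: L2_inner_def distrib_right sq_integrable_mult)

lemma L2_inner_diff:
  "sq_integrable Q f \<Longrightarrow> sq_integrable Q g \<Longrightarrow> sq_integrable Q h \<Longrightarrow>
     L2_inner Q (\<lambda>y. f y - g y) h = L2_inner Q f h - L2_inner Q g h"
  by (simp add: L2_inner_def left_diff_distrib sq_integrable_mult)

lemma L2_inner_self_nonneg: "0 \<le> L2_inner Q f f"
  by (simp add: L2_inner_def)

lemma L2_Cauchy_Schwarz:
  assumes f: "sq_integrable Q f" and g: "sq_integrable Q g"
  shows "(L2_inner Q f g)\<^sup>2 \<le> L2_inner Q f f * L2_inner Q g g"
proof (rule sq_le_mult_of_nonneg_form)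
  fix s t :: real
  let ?h = "\<lambda>y. s * f y + t * g y"
  have h: "sq_integrable Q ?h" by (intro sq_integrable_add sq_integrable_cmult f g)
  have "L2_inner Q ?h k = s * L2_inner Q f k + t * L2_inner Q g k" if "sq_integrable Q k" for k
    using that by (simp add: L2_inner_add sq_integrable_cmult f g L2_inner_cmult)
  then have "L2_inner Q ?h ?h = s\<^sup>2 * L2_inner Q f f + 2 * s * t * L2_inner Q f g + t\<^sup>2 * L2_inner Q g g"
    using f g h L2_inner_commute[of Q f ?h] L2_inner_commute[of Q g ?h] L2_inner_commute[of Q g f]
    by (simp add: power2_eq_square algebra_simps)
  with L2_inner_self_nonneg[of Q ?h]
  show "0 \<le> s\<^sup>2 * L2_inner Q f f + 2 * s * t * L2_inner Q f g + t\<^sup>2 * L2_inner Q g g" by simp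
qed

text \<open>Gram--Schmidt: the projection onto the span of \<open>S\<close> is corrected by the component along
  \<open>h\<close>, the part of the new generator that is orthogonal to \<open>S\<close>.  The generators may be
  dependent as elements of \<open>L\<^sup>2\<close>.  Then \<open>h\<close> may be null, the coefficient \<open>t\<close> has the value
  \<open>x / 0 = 0\<close>, and Cauchy--Schwarz gives orthogonality to \<open>h\<close>.\<close>

lemma ex_L2_projection:
  assumes "finite S" "\<And>a. a \<in> S \<Longrightarrow> sq_integrable Q (b a)" "sq_integrable Q f"
  shows "\<exists>c. \<forall>a\<in>S. L2_inner Q (\<lambda>y. f y - (\<Sum>a\<in>S. c a * b a y)) (b a) = 0"
  using assms
proof (induction S arbitrary: f)
  case empty
  show ?case by simp
next
  case (insert s S)
  note b = insert.prems(1)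
  obtain c where c: "\<And>a. a \<in> S \<Longrightarrow> L2_inner Q (\<lambda>y. f y - (\<Sum>a\<in>S. c a * b a y)) (b a) = 0"
    using insert.IH[OF b insert.prems(2)] by blast
  obtain e where e: "\<And>a. a \<in> S \<Longrightarrow> L2_inner Q (\<lambda>y. b s y - (\<Sum>a\<in>S. e a * b a y)) (b a) = 0"
    using insert.IH[OF b, of "b s"] b by blast
  define E where "E y = (\<Sum>a\<in>S. e a * b a y)" for y
  define g where "g y = f y - (\<Sum>a\<in>S. c a * b a y)" for y
  define h where "h y = b s y - E y" for y
  have E: "sq_integrable Q E"
    unfolding E_def by (intro sq_integrable_sum sq_integrable_cmult b) simp
  have g: "sq_integrable Q g"
    unfolding g_def by (intro sq_integrable_diff sq_integrable_sum sq_integrable_cmult b insert.prems) simp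
  have h: "sq_integrable Q h" unfolding h_def by (intro sq_integrable_diff E b) simp
  have gb: "L2_inner Q g (b a) = 0" and hb: "L2_inner Q h (b a) = 0" if "a \<in> S" for a
    using c[OF that] e[OF that] by (simp_all add: g_def[abs_def] h_def[abs_def] E_def)
  have orth_E: "L2_inner Q k E = 0" if "sq_integrable Q k" "\<And>a. a \<in> S \<Longrightarrow> L2_inner Q k (b a) = 0" for k
  proof -
    have "L2_inner Q k E = (\<Sum>a\<in>S. e a * L2_inner Q k (b a))"
      unfolding L2_inner_def E_def sum_distrib_left
      using that b by (subst Bochner_Integration.integral_sum)
        (auto simp: ac_simps intro!: sum.cong sq_integrable_mult sq_integrable_cmult)
    with that show ?thesis by simp
  qed
  define t where "t = L2_inner Q g h / L2_inner Q h h"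
  define k where "k y = g y - t * h y" for y
  have k: "sq_integrable Q k" unfolding k_def by (intro sq_integrable_diff sq_integrable_cmult g h)
  have kL: "L2_inner Q k u = L2_inner Q g u - t * L2_inner Q h u" if "sq_integrable Q u" for u
    unfolding k_def using that by (simp add: L2_inner_diff L2_inner_cmult g h sq_integrable_cmult)
  have kb: "L2_inner Q k (b a) = 0" if "a \<in> S" for a
    using that b by (simp add: kL gb hb)
  have kh: "L2_inner Q k h = 0"
  proof (cases "L2_inner Q h h = 0")
    case True
    then show ?thesis using L2_Cauchy_Schwarz[OF k h] by simp
  next
    case False
    then show ?thesis by (simp add: kL h t_def)
  qed
  have "L2_inner Q k (b s) = L2_inner Q k h + L2_inner Q k E"
    using L2_inner_add[OF h E k] by (simp add: L2_inner_commute[of Q k] h_def)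
  then have ks: "L2_inner Q k (b s) = 0" using kh orth_E[OF k kb] by simp
  define c' where "c' a = (if a = s then t else c a - t * e a)" for a
  have "k y = f y - (\<Sum>a\<in>insert s S. c' a * b a y)" for y
  proof -
    have "(\<Sum>a\<in>S. c' a * b a y) = (\<Sum>a\<in>S. c a * b a y - t * (e a * b a y))"
      using insert.hyps by (intro sum.cong) (auto simp: c'_def algebra_simps)
    also have "\<dots> = (\<Sum>a\<in>S. c a * b a y) - t * E y"
      by (simp add: sum_subtractf E_def sum_distrib_left)
    finally show ?thesis
      using insert.hyps by (simp add: k_def g_def h_def c'_def algebra_simps)
  qed
  then have "k = (\<lambda>y. f y - (\<Sum>a\<in>insert s S. c' a * b a y))" by auto
  with ks kb show ?case by (intro exI[of _ c']) auto
qed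

context moment_limit_of_signs
begin

lemma sq_integrable_poly: "p \<in> poly_funs D \<Longrightarrow> sq_integrable Q p"
  unfolding sq_integrable_def
  using integrable_poly integrable_poly[OF poly_funs_power] borel_measurable_integrable by blast

lemma L2_proj_poly_funs:
  assumes f: "sq_integrable Q f"
  shows "L2_proj Q (poly_funs D) f \<in> poly_funs D"
    and "q \<in> poly_funs D \<Longrightarrow> L2_inner Q (\<lambda>y. f y - L2_proj Q (poly_funs D) f y) q = 0"
proof -
  let ?S = "{a :: 'n \<Rightarrow> nat. (\<Sum>i\<in>UNIV. a i) \<le> D}"
  obtain c where c: "\<And>a. a \<in> ?S \<Longrightarrow>
      L2_inner Q (\<lambda>y. f y - (\<Sum>a\<in>?S. c a * monomial_fun a y)) (monomial_fun a) = 0"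
    using ex_L2_projection[OF finite_exponents _ f, of D monomial_fun]
      sq_integrable_poly[OF monomial_fun_in_poly_funs] by blast
  define p where "p y = (\<Sum>a\<in>?S. c a * monomial_fun a y)" for y
  have p: "p \<in> poly_funs D" unfolding p_def by (rule poly_funs_combination)
  have fp: "sq_integrable Q (\<lambda>y. f y - p y)" by (intro sq_integrable_diff f sq_integrable_poly[OF p])
  have orth: "L2_inner Q (\<lambda>y. f y - p y) q = 0" if "q \<in> poly_funs D" for q
    using that
  proof (induction rule: poly_funs_monomial_induct)
    case (monomial e a)
    then show ?case using c[of a]
      by (simp add: L2_inner_commute[of Q "\<lambda>y. f y - p y"] L2_inner_cmult) (simp add: p_def L2_inner_commute)
  next
    case (add q r)
    then show ?case
      using L2_inner_add[OF sq_integrable_poly sq_integrable_poly fp]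
      by (simp add: L2_inner_commute[of Q "\<lambda>y. f y - p y"])
  qed
  have "L2_proj Q (poly_funs D) f \<in> poly_funs D \<and>
      (\<forall>q\<in>poly_funs D. L2_inner Q (\<lambda>y. f y - L2_proj Q (poly_funs D) f y) q = 0)"
    unfolding L2_proj_def by (rule someI[of _ p]) (use p orth in blast)
  then show "L2_proj Q (poly_funs D) f \<in> poly_funs D"
    "q \<in> poly_funs D \<Longrightarrow> L2_inner Q (\<lambda>y. f y - L2_proj Q (poly_funs D) f y) q = 0" by auto
qed

text \<open>Testing against a single polynomial \<open>q\<close> bounds the low-degree projection of \<open>f\<close> from below,
  because \<open>f\<close> and its projection have the same inner product with \<open>q\<close>.\<close>

lemma L2_norm_proj_ge:
  assumes f: "sq_integrable Q f" and q: "q \<in> poly_funs D"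
  shows "L2_inner Q f q \<le> L2_norm Q (L2_proj Q (poly_funs D) f) * L2_norm Q q"
proof -
  let ?p = "L2_proj Q (poly_funs D) f"
  have p: "sq_integrable Q ?p" and q': "sq_integrable Q q"
    using L2_proj_poly_funs(1)[OF f] q by (auto intro: sq_integrable_poly)
  have "L2_inner Q f q = L2_inner Q ?p q"
    using L2_proj_poly_funs(2)[OF f q] L2_inner_diff[OF f p q'] by simp
  also have "\<dots> \<le> sqrt ((L2_inner Q ?p q)\<^sup>2)" by simp
  also have "\<dots> \<le> sqrt (L2_inner Q ?p ?p * L2_inner Q q q)"
    by (intro real_sqrt_le_mono L2_Cauchy_Schwarz p q')
  finally show ?thesis by (simp add: L2_norm_def real_sqrt_mult)
qed

end

text \<open>Reading the extended Radon--Nikodym derivative as a real number loses nothing, because it is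
  finite almost everywhere.\<close>

lemma likelihood_ratio_integral:
  assumes Q: "prob_space Q" and P: "prob_space P" and ac: "absolutely_continuous Q P"
    and sets: "sets P = sets Q" and f: "f \<in> borel_measurable Q"
  shows "integrable P f \<longleftrightarrow> integrable Q (\<lambda>y. likelihood_ratio Q P y * f y)"
    and "(\<integral>y. f y \<partial>P) = L2_inner Q (likelihood_ratio Q P) f"
proof -
  interpret Q: prob_space Q by fact
  interpret P: prob_space P by fact
  have fin: "AE y in Q. RN_deriv Q P y \<noteq> \<infinity>"
    by (intro Q.RN_deriv_finite ac sets P.sigma_finite_measure_axioms)
  have "P = density Q (RN_deriv Q P)" using Q.density_RN_deriv[OF ac sets] by simp
  also have "\<dots> = density Q (\<lambda>y. ennreal (likelihood_ratio Q P y))"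
    using fin by (intro density_cong) (auto simp: likelihood_ratio_def less_top)
  finally have eq: "P = density Q (\<lambda>y. ennreal (likelihood_ratio Q P y))" .
  have L: "likelihood_ratio Q P \<in> borel_measurable Q"
    unfolding likelihood_ratio_def[abs_def] by measurable
  have L0: "0 \<le> likelihood_ratio Q P y" for y by (simp add: likelihood_ratio_def)
  show "integrable P f \<longleftrightarrow> integrable Q (\<lambda>y. likelihood_ratio Q P y * f y)"
    by (subst eq, subst integrable_density) (use f L L0 in auto)
  show "(\<integral>y. f y \<partial>P) = L2_inner Q (likelihood_ratio Q P) f"
    unfolding L2_inner_def by (subst eq, subst integral_density) (use f L L0 in auto)
qed

context moment_limit_of_signs
begin

text \<open>A polynomial cannot have most of its second moment on a very unlikely event.  By
  Cauchy--Schwarz and hypercontractivity, the contribution of the event is at most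
  \<open>sqrt (1 / 2) \<le> 3 / 4\<close> times the whole second moment, which can be absorbed; outside the
  event the bound \<open>c\<close> applies.\<close>

lemma poly_second_moment_le:
  assumes p: "p \<in> poly_funs D" and E: "{y \<in> space Q. E y} \<in> sets Q"
    and small: "measure Q {y \<in> space Q. E y} \<le> 1 / (2 * 9 ^ D)"
    and bound: "\<And>y. y \<in> space Q \<Longrightarrow> \<not> E y \<Longrightarrow> \<bar>p y\<bar> \<le> c"
  shows "L2_inner Q p p \<le> 4 * c\<^sup>2"
proof -
  interpret prob_space Q by (rule prob)
  let ?X = "{y \<in> space Q. E y}" and ?m = "\<integral>y. (p y)\<^sup>2 \<partial>Q"
  have p2: "(\<lambda>y. (p y)\<^sup>2) \<in> poly_funs (2 * D)" by (rule poly_funs_power[OF p])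
  have ind: "sq_integrable Q (indicator ?X :: _ \<Rightarrow> real)"
    using E by (auto simp: sq_integrable_def power2_eq_square less_top[symmetric] simp flip: indicator_inter_arith
        intro!: integrable_real_indicator)
  have int: "integrable Q (\<lambda>y. (p y)\<^sup>2 * indicator ?X y)"
    by (rule sq_integrable_mult[OF sq_integrable_poly[OF p2] ind])
  have "(\<integral>y. (p y)\<^sup>2 * indicator ?X y \<partial>Q)\<^sup>2 \<le> (\<integral>y. p y ^ 4 \<partial>Q) * measure Q ?X"
    using L2_Cauchy_Schwarz[OF sq_integrable_poly[OF p2] ind] E
    by (simp add: L2_inner_def flip: power_add indicator_inter_arith)
  also have "\<dots> \<le> (9 ^ D * ?m\<^sup>2) * (1 / (2 * 9 ^ D))"
    by (intro mult_mono hypercontractive[OF p] small) auto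
  also have "\<dots> \<le> (3 / 4 * ?m)\<^sup>2" by (simp add: power2_eq_square)
  finally have tail: "(\<integral>y. (p y)\<^sup>2 * indicator ?X y \<partial>Q) \<le> 3 / 4 * ?m"
    by (rule power2_le_imp_le) simp
  have "?m \<le> (\<integral>y. c\<^sup>2 + (p y)\<^sup>2 * indicator ?X y \<partial>Q)"
  proof (rule integral_mono)
    show "integrable Q (\<lambda>y. (p y)\<^sup>2)" by (rule integrable_poly[OF p2])
    show "integrable Q (\<lambda>y. c\<^sup>2 + (p y)\<^sup>2 * indicator ?X y)" using int by simp
    show "(p y)\<^sup>2 \<le> c\<^sup>2 + (p y)\<^sup>2 * indicator ?X y" if "y \<in> space Q" for y
    proof (cases "E y")
      case False
      then have "(p y)\<^sup>2 \<le> c\<^sup>2" using bound[OF that] by (meson abs_ge_self abs_le_square_iff order_trans)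
      then show ?thesis using False by simp
    qed (use that in simp)
  qed
  also have "\<dots> = c\<^sup>2 + (\<integral>y. (p y)\<^sup>2 * indicator ?X y \<partial>Q)"
    using int by (simp add: prob_space)
  finally show ?thesis using tail by (simp add: L2_inner_def power2_eq_square)
qed

end

text \<open>Jensen's inequality for the \<open>n\<close>-th power, by way of the tangent at \<open>A\<close>
  (Bernoulli's inequality).\<close>

lemma power_le_expectation_of_power:
  fixes X f :: "'a \<Rightarrow> real"
  assumes P: "prob_space P" and X: "integrable P X" "\<And>y. 0 \<le> X y"
    and f: "integrable P f" "\<And>y. X y ^ n \<le> f y" and A: "0 < A" "A \<le> (\<integral>y. X y \<partial>P)"
  shows "A ^ n \<le> (\<integral>y. f y \<partial>P)"
proof -
  interpret prob_space P by fact
  have "A ^ n \<le> A ^ n * (1 + real n * ((\<integral>y. X y \<partial>P) / A - 1))"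
    using A by simp
  also have "\<dots> = (\<integral>y. A ^ n * (1 + real n * (X y / A - 1)) \<partial>P)"
    using X by (simp add: prob_space)
  also have "\<dots> \<le> (\<integral>y. f y \<partial>P)"
  proof (rule integral_mono)
    fix y
    have "1 + real n * (X y / A - 1) \<le> (X y / A) ^ n"
      using Bernoulli_inequality[of "X y / A - 1" n] X(2)[of y] A(1) by simp
    then have "A ^ n * (1 + real n * (X y / A - 1)) \<le> A ^ n * (X y / A) ^ n"
      using A(1) by (intro mult_left_mono) auto
    also have "\<dots> = X y ^ n" using A(1) by (simp add: power_divide)
    finally show "A ^ n * (1 + real n * (X y / A - 1)) \<le> f y" using f(2)[of y] by simp
  qed (use X f in simp_all)
  finally show ?thesis .
qed

section \<open>Operator norms and the low-degree likelihood ratio\<close>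

theorem theorem4p4:
  fixes Q P :: "(real ^ 'n) measure"
    and M :: "real ^ 'n \<Rightarrow> real ^ 'l ^ 'l"
    and d k :: nat
    and A B \<delta> :: real
  assumes "Q = iid_law std_normal_law \<or> Q = iid_law rademacher_law"
    and "prob_space P" and "sets P = sets borel"
    and "absolutely_continuous Q P"
    and "integrable Q (\<lambda>y. (likelihood_ratio Q P y)\<^sup>2)"
    and "\<And>y. transpose (M y) = M y"
    and "\<And>i j. (\<lambda>y. M y $ i $ j) \<in> poly_funs d"
    and "(\<integral>y. op_norm (M y) \<partial>P) \<ge> A"
    and "measure Q {y \<in> space Q. op_norm (M y) \<ge> B} \<le> \<delta>"
    and "A > B" and "B > 0"
    and "\<delta> \<le> 1 / 2 * 3 powi (- int (4 * k * d))"
  shows "L2_norm Q (low_degree_LR Q P (2 * k * d)) \<ge> 1 / (2 * real CARD('l)) * (A / B) ^ (2 * k)"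
proof -
  obtain vs where "moment_limit_of_signs Q vs"
    using gaussian_or_rademacher_moment_limit_of_signs[OF assms(1)] by blast
  then interpret moment_limit_of_signs Q vs .
  define L where "L = likelihood_ratio Q P"
  define f where "f y = (norm (mat_pow (M y) k))\<^sup>2" for y
  define D where "D = 2 * k * d"
  have sets_PQ: "sets P = sets Q" by (simp add: assms(3) sets)
  have f: "f \<in> poly_funs D"
    unfolding f_def[abs_def] D_def by (intro poly_funs_norm_mat_pow assms(7))
  have f_meas: "f \<in> borel_measurable Q"
    using sq_integrable_poly[OF f] by (simp add: sq_integrable_def)
  have L: "sq_integrable Q L"
    using assms(5) by (simp add: sq_integrable_def L_def likelihood_ratio_def[abs_def])
  note LR = likelihood_ratio_integral[OF prob assms(2,4) sets_PQ]
  \<comment> \<open>The integral of a non-integrable function is \<open>0\<close>, but here it is at least \<open>A > 0\<close>.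
    Integrability also provides measurability of the operator norm.\<close>
  have X_int: "integrable P (\<lambda>y. op_norm (M y))"
    using assms(8,10,11) not_integrable_integral_eq by fastforce
  have X_meas: "(\<lambda>y. op_norm (M y)) \<in> borel_measurable Q"
    using borel_measurable_integrable[OF X_int] measurable_cong_sets[OF sets_PQ refl] by blast
  have "A ^ (2 * k) \<le> (\<integral>y. f y \<partial>P)"
  proof (rule power_le_expectation_of_power[OF assms(2) X_int])
    show "integrable P f"
      using LR(1)[OF f_meas] sq_integrable_mult[OF L sq_integrable_poly[OF f]] by (simp add: L_def)
    show "op_norm (M y) ^ (2 * k) \<le> f y" for y
      unfolding f_def by (rule norm_mat_pow_ge[OF assms(6)])
  qed (use assms op_norm_ge_0 in auto)
  also have "\<dots> = L2_inner Q L f" unfolding L_def by (rule LR(2)[OF f_meas])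
  also have "\<dots> \<le> L2_norm Q (low_degree_LR Q P D) * L2_norm Q f"
    unfolding low_degree_LR_def L_def[symmetric] by (rule L2_norm_proj_ge[OF L f])
  also have "\<dots> \<le> L2_norm Q (low_degree_LR Q P D) * (2 * (real CARD('l) * B ^ (2 * k)))"
  proof (rule mult_left_mono)
    have "L2_inner Q f f \<le> 4 * (real CARD('l) * B ^ (2 * k))\<^sup>2"
    proof (rule poly_second_moment_le[OF f, where E = "\<lambda>y. op_norm (M y) \<ge> B"])
      show "{y \<in> space Q. op_norm (M y) \<ge> B} \<in> Sigma_Algebra.sets Q" using X_meas by measurable
      have "(3::real) powi (- int (4 * k * d)) = 1 / 3 ^ (2 * D)"
        by (simp only: power_int_minus power_int_of_nat) (simp add: D_def divide_inverse ac_simps)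
      also have "\<dots> = 1 / 9 ^ D" by (simp add: power_mult)
      finally show "measure Q {y \<in> space Q. op_norm (M y) \<ge> B} \<le> 1 / (2 * 9 ^ D)"
        using assms(9,12) by simp
      fix y assume "\<not> op_norm (M y) \<ge> B"
      then have "op_norm (M y) ^ (2 * k) \<le> B ^ (2 * k)" by (intro power_mono op_norm_ge_0) simp
      then have "f y \<le> real CARD('l) * B ^ (2 * k)"
        unfolding f_def using norm_mat_pow_le[of "M y" k]
        by (meson mult_left_mono of_nat_0_le_iff order_trans)
      then show "\<bar>f y\<bar> \<le> real CARD('l) * B ^ (2 * k)" by (simp add: f_def)
    qed
    also have "\<dots> = (2 * (real CARD('l) * B ^ (2 * k)))\<^sup>2" by (simp add: power2_eq_square)
    finally show "L2_norm Q f \<le> 2 * (real CARD('l) * B ^ (2 * k))"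
      unfolding L2_norm_def using assms(11) by (intro real_le_lsqrt) auto
    show "0 \<le> L2_norm Q (low_degree_LR Q P D)"
      by (simp add: L2_norm_def L2_inner_self_nonneg)
  qed
  finally show ?thesis
    using assms(11) by (simp add: D_def power_divide field_simps)
qed

end
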